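(* Let $n\ge 1$ and $d\ge 2$ be integers, let $A_1,\dots,A_n$ be $n$ qudit systems, each with Hilbert space $\mathbb{C}^d$ and orthonormal basis $|0\rangle,\dots,|d-1\rangle$, and let $$|W_n^d\rangle_{A_1\cdots A_n}=\sum_{i=1}^{d-1}\bigl(a_{1i}|i0\cdots 0\rangle+a_{2i}|0i\cdots 0\rangle+\cdots+a_{ni}|0\cdots 0i\rangle\bigr)_{A_1\cdots A_n},\qquad a_{si}\in\mathbb{C},\quad \sum_{s=1}^n\sum_{i=1}^{d-1}|a_{si}|^2=1,$$ be a generalized W-class state. Let $0\le p\le 1$ and let $\rho_{A_1\cdots A_n}\in\mathcal{B}((\mathbb{C}^d)^{\otimes n})$ be the mixed state $$\rho_{A_1\cdots A_n}=p\,|W_n^d\rangle\langle W_n^d|+(1-p)\,|0\cdots 0\rangle\langle 0\cdots 0|.$$ Then, with all concurrences and concurrences of assistance taken with respect to $\rho_{A_1\cdots A_n}$ and its reduced states, $$\mathcal{C}_{A_1(A_2\cdots A_n)}^2=\mathcal{C}_{A_1A_2}^2+\cdots+\mathcal{C}_{A_1A_n}^2,\qquad \mathcal{C}_{A_1A_t}=\mathcal{C}^a_{A_1A_t}\quad\text{for } t=2,\dots,n.$$ Furthermore, for any partition $P=\{P_1,\dots,P_m\}$ of the set of subsystems $S=\{A_1,\dots,A_n\}$ and every $s\in\{1,\dots,m\}$, $$\mathcal{C}_{P_s(P_1\cdots\widehat{P}_s\cdots P_m)}^2=\sum_{k\ne s}\mathcal{C}_{P_sP_k}^2=\sum_{k\ne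 s}(\mathcal{C}_{P_sP_k}^a)^2,$$ and $\mathcal{C}_{P_sP_k}=\mathcal{C}^a_{P_sP_k}$ for all $k\ne s$.
   Context: Concurrence. For a normalized pure state $|\phi\rangle_{AB}$ of a bipartite finite-dimensional system $\mathcal{H}_A\otimes\mathcal{H}_B$, $\mathcal{C}(|\phi\rangle_{AB})=\sqrt{2(1-\mathrm{tr}\,\rho_A^2)}$, where $\rho_A=\mathrm{tr}_B|\phi\rangle\langle\phi|$. For a mixed state (density operator) $\rho_{AB}$, the concurrence is $\mathcal{C}(\rho_{AB})=\min\sum_k p_k\,\mathcal{C}(|\phi_k\rangle_{AB})$ and the concurrence of assistance is $\mathcal{C}^a(\rho_{AB})=\max\sum_k p_k\,\mathcal{C}(|\phi_k\rangle_{AB})$, where the minimum and the maximum are over all (finite) pure state decompositions $\rho_{AB}=\sum_k p_k|\phi_k\rangle\langle\phi_k|$ with $p_k\geq 0$, $\sum_k p_k=1$, and the $|\phi_k\rangle$ normalized. Notation. Given a state of $A_1\otimes\cdots\otimes A_n$ and disjoint sets $X,Y$ of subsystems, $\mathcal{C}_{XY}$ (also written $\mathcal{C}_{X(Y)}$) and $\mathcal{C}^a_{XY}$ denote the concurrence and concurrence of assistance of the reduced state $\rho_{XY}$ on $X\cup Y$ (obtained by the partial trace over all other subsystems), viewed as a bipartite state with respect to the cut between $X$ and $Y$. If $X\cup Y$ is the whole set of subsystems, $\rho_{XY}$ is the given state itself. A partition $P=\{P_1,\dots,P_m\}$ of $S$ consists of nonempty pairwise disjoint sets with union $S$; each $P_s$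 is regarded as one party, whose Hilbert space is the tensor product of the spaces of the qudits in it. A hat denotes omission, so $P_1\cdots\widehat{P}_s\cdots P_m$ is the joint system of all parties other than $P_s$. An empty tensor product is $\mathbb{C}$. *)

theory Defs
  imports "HOL-Analysis.Finite_Product_Measure" "HOL-Library.Disjoint_Sets"
begin

text \<open>
  The Hilbert space with orthonormal basis labelled by a finite set \<open>I\<close> is represented by its
  coordinates: vectors are functions on labels, operators are functions on pairs of labels, and
  only the values at labels in \<open>I\<close> are significant. The tensor product of the spaces over \<open>I\<close>
  and \<open>J\<close> is the space over \<open>I \<times> J\<close>.
\<close>

type_synonym 'i vector = "'i \<Rightarrow> complex"
type_synonym 'i operator = "'i \<Rightarrow> 'i \<Rightarrow> complex"

definition ket :: "'i \<Rightarrow> 'i vector" where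
  "ket x = (\<lambda>y. if y = x then 1 else 0)"

definition ketbra :: "'i vector \<Rightarrow> 'i vector \<Rightarrow> 'i operator" where
  "ketbra \<phi> \<psi> = (\<lambda>x y. \<phi> x * cnj (\<psi> y))"

definition normalized :: "'i set \<Rightarrow> 'i vector \<Rightarrow> bool" where
  "normalized I \<phi> \<longleftrightarrow> (\<Sum>x\<in>I. (cmod (\<phi> x))\<^sup>2) = 1"

definition op_mult :: "'i set \<Rightarrow> 'i operator \<Rightarrow> 'i operator \<Rightarrow> 'i operator" where
  "op_mult I A B = (\<lambda>x y. \<Sum>z\<in>I. A x z * B z y)"

definition op_trace :: "'i set \<Rightarrow> 'i operator \<Rightarrow> complex" where
  "op_trace I A = (\<Sum>x\<in>I. A x x)"

definition trace_right :: "'j set \<Rightarrow> ('i \<times> 'j) operator \<Rightarrow> 'i operator" where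
  "trace_right J \<rho> = (\<lambda>x x'. \<Sum>y\<in>J. \<rho> (x, y) (x', y))"

definition pure_concurrence :: "'i set \<Rightarrow> 'j set \<Rightarrow> ('i \<times> 'j) vector \<Rightarrow> real" where
  "pure_concurrence I J \<phi> =
     (let \<rho>A = trace_right J (ketbra \<phi> \<phi>)
      in sqrt (2 * (1 - Re (op_trace I (op_mult I \<rho>A \<rho>A)))))"

definition pure_decomposition ::
  "'i set \<Rightarrow> 'i operator \<Rightarrow> nat \<Rightarrow> (nat \<Rightarrow> real) \<Rightarrow> (nat \<Rightarrow> 'i vector) \<Rightarrow> bool" where
  "pure_decomposition I \<rho> K p \<phi> \<longleftrightarrow>
     (\<forall>k<K. 0 \<le> p k) \<and> (\<Sum>k<K. p k) = 1 \<and> (\<forall>k<K. normalized I (\<phi> k)) \<and>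
     (\<forall>x\<in>I. \<forall>y\<in>I. \<rho> x y = (\<Sum>k<K. complex_of_real (p k) * ketbra (\<phi> k) (\<phi> k) x y))"

definition average_concurrences :: "'i set \<Rightarrow> 'j set \<Rightarrow> ('i \<times> 'j) operator \<Rightarrow> real set" where
  "average_concurrences I J \<rho> =
     {\<Sum>k<K. p k * pure_concurrence I J (\<phi> k) |K p \<phi>. pure_decomposition (I \<times> J) \<rho> K p \<phi>}"

text \<open>
  For a density operator both extrema are attained (by compactness, since boundedly many terms
  suffice by Caratheodory's theorem), hence \<open>LEAST\<close> and \<open>GREATEST\<close> rather than
  \<open>Inf\<close> and \<open>Sup\<close>.
\<close>

definition concurrence :: "'i set \<Rightarrow> 'j set \<Rightarrow> ('i \<times> 'j) operator \<Rightarrow> real" where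
  "concurrence I J \<rho> = (LEAST c. c \<in> average_concurrences I J \<rho>)"

definition concurrence_of_assistance ::
  "'i set \<Rightarrow> 'j set \<Rightarrow> ('i \<times> 'j) operator \<Rightarrow> real" where
  "concurrence_of_assistance I J \<rho> = (GREATEST c. c \<in> average_concurrences I J \<rho>)"

text \<open>
  Basis labels of the joint space of the qudits in a set \<open>X\<close>. For \<open>X = {}\<close> there is exactly one
  label, so the space is one-dimensional.
\<close>

definition configs :: "nat \<Rightarrow> nat set \<Rightarrow> (nat \<Rightarrow> nat) set" where
  "configs d X = (X \<rightarrow>\<^sub>E {..<d})"

text \<open>
  \<open>reduced_state d S \<rho> X\<close> traces the qudits in \<open>S - X\<close> out of an operator \<open>\<rho>\<close> on the qudits
  in \<open>S\<close>; \<open>bipartite_cut X Y\<close> identifies the space of \<open>X \<union> Y\<close> (for disjoint \<open>X\<close> and \<open>Y\<close>)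
  with the tensor product of the spaces of \<open>X\<close> and \<open>Y\<close>.
\<close>

definition reduced_state ::
  "nat \<Rightarrow> nat set \<Rightarrow> (nat \<Rightarrow> nat) operator \<Rightarrow> nat set \<Rightarrow> (nat \<Rightarrow> nat) operator" where
  "reduced_state d S \<rho> X =
     (\<lambda>x x'. \<Sum>z\<in>configs d (S - X). \<rho> (merge X (S - X) (x, z)) (merge X (S - X) (x', z)))"

definition bipartite_cut ::
  "nat set \<Rightarrow> nat set \<Rightarrow> (nat \<Rightarrow> nat) operator \<Rightarrow> ((nat \<Rightarrow> nat) \<times> (nat \<Rightarrow> nat)) operator" where
  "bipartite_cut X Y \<sigma> = (\<lambda>u v. \<sigma> (merge X Y u) (merge X Y v))"

definition conc :: "nat \<Rightarrow> nat \<Rightarrow> (nat \<Rightarrow> nat) operator \<Rightarrow> nat set \<Rightarrow> nat set \<Rightarrow> real" where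
  "conc n d \<rho> X Y =
     concurrence (configs d X) (configs d Y)
       (bipartite_cut X Y (reduced_state d {1..n} \<rho> (X \<union> Y)))"

definition conc_assist ::
  "nat \<Rightarrow> nat \<Rightarrow> (nat \<Rightarrow> nat) operator \<Rightarrow> nat set \<Rightarrow> nat set \<Rightarrow> real" where
  "conc_assist n d \<rho> X Y =
     concurrence_of_assistance (configs d X) (configs d Y)
       (bipartite_cut X Y (reduced_state d {1..n} \<rho> (X \<union> Y)))"

definition zero_label :: "nat \<Rightarrow> nat \<Rightarrow> nat" where
  "zero_label n = (\<lambda>t\<in>{1..n}. 0)"

definition excited_label :: "nat \<Rightarrow> nat \<Rightarrow> nat \<Rightarrow> nat \<Rightarrow> nat" where
  "excited_label n s i = (\<lambda>t\<in>{1..n}. if t = s then i else 0)"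

definition W_state :: "nat \<Rightarrow> nat \<Rightarrow> (nat \<Rightarrow> nat \<Rightarrow> complex) \<Rightarrow> (nat \<Rightarrow> nat) vector" where
  "W_state n d a = (\<lambda>x. \<Sum>i=1..d-1. \<Sum>s=1..n. a s i * ket (excited_label n s i) x)"

definition W_mixture ::
  "nat \<Rightarrow> nat \<Rightarrow> (nat \<Rightarrow> nat \<Rightarrow> complex) \<Rightarrow> real \<Rightarrow> (nat \<Rightarrow> nat) operator" where
  "W_mixture n d a p = (\<lambda>x y.
     complex_of_real p * ketbra (W_state n d a) (W_state n d a) x y +
     complex_of_real (1 - p) * ketbra (ket (zero_label n)) (ket (zero_label n)) x y)"

end

theory Submission
  imports Defs
begin

text \<open>
  For disjoint \<open>X\<close> and \<open>Y\<close> the reduced state on \<open>X \<union> Y\<close> is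
  \<open>|\<psi>><\<psi>| + q |00><00|\<close> with the unnormalized vector
  \<open>\<psi> = \<alpha> \<otimes> |0> + |0> \<otimes> \<beta>\<close>, where \<open>\<alpha>\<close> and \<open>\<beta>\<close> are orthogonal to \<open>|0>\<close>. Every
  pure state \<open>\<phi>\<^sub>k\<close> in a decomposition lies in the range of this operator, so
  \<open>\<phi>\<^sub>k = c\<^sub>k \<psi> + e\<^sub>k |00>\<close>. Such a state has concurrence \<open>2 |c\<^sub>k|\<^sup>2 \<parallel>\<alpha>\<parallel> \<parallel>\<beta>\<parallel>\<close>, independently
  of \<open>e\<^sub>k\<close>, and \<open>\<Sum> p\<^sub>k |c\<^sub>k|\<^sup>2 = 1\<close>. Hence all decompositions have the same average concurrence,
  which gives \<open>C = C\<^sup>a = 2 p sqrt (w(X) w(Y))\<close> with the additive weight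
  \<open>w(X) = \<Sum> |a\<^sub>s\<^sub>i|\<^sup>2\<close> over \<open>s \<in> X\<close>.
\<close>

section \<open>Basis vectors and sums of orthogonal components\<close>

lemma sum_ket_mult [simp]:
  assumes "finite I" "i \<in> I"
  shows "(\<Sum>x\<in>I. ket i x * f x) = f i" "(\<Sum>x\<in>I. f x * ket i x) = f i"
  using assms by (simp_all add: ket_def if_distrib if_distribR cong: if_cong)

lemma cnj_ket [simp]: "cnj (ket i x) = ket i x"
  by (simp add: ket_def)

lemma ket_mult_self [simp]: "ket i x * ket i x = ket i x"
  by (simp add: ket_def)

text \<open>Since \<beta> vanishes at \<open>j0\<close>, it is orthogonal to \<open>ket j0\<close>
  and both cross terms drop out. The coefficients are free, so the identity yields norms as well as
  partial traces.\<close>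

lemma sum_ket_orthogonal:
  fixes \<beta> :: "'j vector"
  assumes J: "finite J" "j0 \<in> J" and \<beta>: "\<beta> j0 = 0"
  shows "(\<Sum>y\<in>J. (u * ket j0 y + v * \<beta> y) * cnj (u' * ket j0 y + v' * \<beta> y)) =
    u * cnj u' + v * cnj v' * complex_of_real (\<Sum>y\<in>J. (cmod (\<beta> y))\<^sup>2)"
proof -
  have "(\<Sum>y\<in>J. (u * ket j0 y + v * \<beta> y) * cnj (u' * ket j0 y + v' * \<beta> y)) =
      (\<Sum>y\<in>J. ket j0 y * (u * cnj u' + v * cnj u' * \<beta> y + u * cnj v' * cnj (\<beta> y)) +
        v * cnj v' * (\<beta> y * cnj (\<beta> y)))"
    by (intro sum.cong) (auto simp: ket_def algebra_simps)
  also have "\<dots> = u * cnj u' + v * cnj v' * (\<Sum>y\<in>J. \<beta> y * cnj (\<beta> y))"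
    using J \<beta> by (simp add: sum.distrib sum_distrib_left)
  finally show ?thesis by (simp add: complex_norm_square del: of_real_power)
qed

section \<open>Average concurrence over pure state decompositions\<close>

text \<open>Tracing out the second factor leaves \<open>R\<close>: the rank-one operator of
  \<open>g\<close> plus \<open>b\<close> times the projector on \<open>ket i0\<close>. Its purity
  depends only on the norm of \<open>g\<close>, the overlap \<open>g i0 = e\<close> and
  \<open>b\<close>; normalization then makes \<open>e\<close> cancel.\<close>

lemma pure_concurrence_W:
  fixes \<alpha> :: "'i vector" and \<beta> :: "'j vector"
  assumes I: "finite I" "i0 \<in> I" and J: "finite J" "j0 \<in> J"
    and \<alpha>: "\<alpha> i0 = 0" and \<beta>: "\<beta> j0 = 0"
    and \<phi>: "\<And>x y. x \<in> I \<Longrightarrow> y \<in> J \<Longrightarrow>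
      \<phi> (x, y) = c * (\<alpha> x * ket j0 y + ket i0 x * \<beta> y) + e * ket i0 x * ket j0 y"
    and nrm: "normalized (I \<times> J) \<phi>"
  shows "pure_concurrence I J \<phi> =
    2 * (cmod c)\<^sup>2 * sqrt ((\<Sum>x\<in>I. (cmod (\<alpha> x))\<^sup>2) * (\<Sum>y\<in>J. (cmod (\<beta> y))\<^sup>2))"
proof -
  define A where "A = (\<Sum>x\<in>I. (cmod (\<alpha> x))\<^sup>2)"
  define B where "B = (\<Sum>y\<in>J. (cmod (\<beta> y))\<^sup>2)"
  define g where "g x = e * ket i0 x + c * \<alpha> x" for x
  define b where "b = (cmod c)\<^sup>2 * B"
  define R where "R x x' = g x * cnj (g x') + b * (ket i0 x * ket i0 x')" for x x'
  have G: "(\<Sum>x\<in>I. g x * cnj (g x)) = complex_of_real ((cmod e)\<^sup>2 + (cmod c)\<^sup>2 * A)"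
    unfolding g_def using sum_ket_orthogonal[of I i0 \<alpha> e c e c, OF I \<alpha>]
    by (simp add: A_def complex_norm_square del: of_real_power)
  have g0: "g i0 = e" using \<alpha> by (simp add: g_def ket_def)
  have R: "trace_right J (ketbra \<phi> \<phi>) x x' = R x x'" if "x \<in> I" "x' \<in> I" for x x'
  proof -
    have "trace_right J (ketbra \<phi> \<phi>) x x' =
      (\<Sum>y\<in>J. (g x * ket j0 y + (c * ket i0 x) * \<beta> y) *
         cnj (g x' * ket j0 y + (c * ket i0 x') * \<beta> y))"
      unfolding trace_right_def ketbra_def using that
      by (intro sum.cong) (auto simp: \<phi> g_def algebra_simps)
    also have "\<dots> = R x x'"
      unfolding sum_ket_orthogonal[of J j0 \<beta>, OF J \<beta>]
      by (simp add: R_def b_def B_def complex_norm_square algebra_simps del: of_real_power)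
    finally show ?thesis .
  qed
  have trR: "(\<Sum>x\<in>I. R x x) = complex_of_real ((cmod e)\<^sup>2 + (cmod c)\<^sup>2 * A + b)"
    using I by (simp add: R_def sum.distrib G flip: sum_distrib_left) (simp add: ket_def)
  \<comment> \<open>The trace of the reduced operator is the squared norm of the state, so
    normalization becomes a relation between \<open>e\<close>, \<open>c\<close>, \<open>A\<close>
    and \<open>b\<close>.\<close>
  have "complex_of_real (\<Sum>z\<in>I \<times> J. (cmod (\<phi> z))\<^sup>2) =
      (\<Sum>x\<in>I. trace_right J (ketbra \<phi> \<phi>) x x)"
    unfolding trace_right_def ketbra_def
    by (simp add: sum.cartesian_product complex_norm_square case_prod_unfold del: of_real_power)
  also have "\<dots> = complex_of_real ((cmod e)\<^sup>2 + (cmod c)\<^sup>2 * A + b)"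
    using trR by (simp add: R)
  finally have one: "(cmod e)\<^sup>2 + (cmod c)\<^sup>2 * A + b = 1"
    using nrm unfolding normalized_def by (metis of_real_eq_iff)
  have "op_trace I (op_mult I (trace_right J (ketbra \<phi> \<phi>)) (trace_right J (ketbra \<phi> \<phi>))) =
      (\<Sum>x\<in>I. \<Sum>z\<in>I. R x z * R z x)"
    unfolding op_trace_def op_mult_def by (simp add: R)
  \<comment> \<open>All terms containing \<open>b\<close> are supported at
    \<open>x = z = i0\<close>, where \<open>g\<close> takes the value \<open>e\<close>.\<close>
  also have "\<dots> = (\<Sum>x\<in>I. \<Sum>z\<in>I. (g x * cnj (g x)) * (g z * cnj (g z)) +
      ket i0 x * (ket i0 z * (2 * b * (e * cnj e) + b\<^sup>2)))"
    by (intro sum.cong refl)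
      (auto simp: R_def ket_def g0 power2_eq_square algebra_simps)
  also have "\<dots> = (\<Sum>x\<in>I. g x * cnj (g x)) * (\<Sum>z\<in>I. g z * cnj (g z)) +
      (2 * b * (e * cnj e) + b\<^sup>2)"
    using I by (simp add: sum.distrib sum_product flip: sum_distrib_left)
  also have "\<dots> = complex_of_real (((cmod e)\<^sup>2 + (cmod c)\<^sup>2 * A)\<^sup>2 + 2 * b * (cmod e)\<^sup>2 + b\<^sup>2)"
    unfolding G by (simp add: power2_eq_square[of "_ + _"] flip: complex_norm_square)
  finally have tr: "Re (op_trace I (op_mult I (trace_right J (ketbra \<phi> \<phi>))
      (trace_right J (ketbra \<phi> \<phi>)))) =
      ((cmod e)\<^sup>2 + (cmod c)\<^sup>2 * A)\<^sup>2 + 2 * b * (cmod e)\<^sup>2 + b\<^sup>2"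
    by simp
  have "2 * (1 - (((cmod e)\<^sup>2 + (cmod c)\<^sup>2 * A)\<^sup>2 + 2 * b * (cmod e)\<^sup>2 + b\<^sup>2)) =
      (2 * (cmod c)\<^sup>2)\<^sup>2 * (A * B)"
  proof -
    \<comment> \<open>With 1 replaced by the squared trace, the deficit of the purity reduces to
      twice the product of \<open>b\<close> and \<open>(cmod c)\<^sup>2 * A\<close>.\<close>
    have "1 = ((cmod e)\<^sup>2 + (cmod c)\<^sup>2 * A + b)\<^sup>2" using one by simp
    then show ?thesis unfolding b_def by (simp add: power2_eq_square algebra_simps)
  qed
  then show ?thesis
    unfolding pure_concurrence_def Let_def tr A_def[symmetric] B_def[symmetric]
    by (simp only: real_sqrt_mult real_sqrt_abs) simp
qed

text \<open>Off the corner label \<open>(i0, j0)\<close> every term of positive weight is a multiple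
  of \<psi>. The corner entry does not affect the concurrence, and a diagonal entry of \<sigma>
  where \<psi> is nonzero fixes the weighted sum of the squared moduli of the multiples.\<close>

lemma average_concurrence_W:
  fixes \<alpha> :: "'i vector" and \<beta> :: "'j vector"
  assumes I: "finite I" "i0 \<in> I" and J: "finite J" "j0 \<in> J"
    and \<alpha>: "\<alpha> i0 = 0" and \<beta>: "\<beta> j0 = 0"
    and \<psi>: "\<And>x y. \<psi> (x, y) = \<alpha> x * ket j0 y + ket i0 x * \<beta> y"
    and \<sigma>: "\<And>u v. u \<in> I \<times> J \<Longrightarrow> v \<in> I \<times> J \<Longrightarrow>
      \<sigma> u v = ketbra \<psi> \<psi> u v + complex_of_real q * ketbra (ket (i0, j0)) (ket (i0, j0)) u v"
    and dec: "pure_decomposition (I \<times> J) \<sigma> K p \<phi>"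
  shows "(\<Sum>k<K. p k * pure_concurrence I J (\<phi> k)) =
    2 * sqrt ((\<Sum>x\<in>I. (cmod (\<alpha> x))\<^sup>2) * (\<Sum>y\<in>J. (cmod (\<beta> y))\<^sup>2))"
    (is "_ = 2 * ?r")
proof -
  have p: "p k \<ge> 0" if "k < K" for k
    using dec that by (auto simp: pure_decomposition_def)
  have nrm: "normalized (I \<times> J) (\<phi> k)" if "k < K" for k
    using dec that by (auto simp: pure_decomposition_def)
  \<comment> \<open>Away from the corner label the second term of \<sigma> has no entries, so only
    \<psi> enters.\<close>
  have eq: "(\<Sum>k<K. p k * (\<phi> k u * cnj (\<phi> k v))) = \<psi> u * cnj (\<psi> v)"
    if "u \<in> I \<times> J - {(i0, j0)}" "v \<in> I \<times> J - {(i0, j0)}" for u v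
  proof -
    have "\<sigma> u v = (\<Sum>k<K. p k * ketbra (\<phi> k) (\<phi> k) u v)"
      using dec that unfolding pure_decomposition_def by auto
    moreover have "\<sigma> u v = \<psi> u * cnj (\<psi> v)"
      using that by (subst \<sigma>) (auto simp: ketbra_def ket_def)
    ultimately show ?thesis by (simp add: ketbra_def)
  qed
  \<comment> \<open>A functional annihilating \<open>\<psi>\<close> and \<open>|00>\<close> has zero expectation in \<open>\<sigma>\<close>, hence vanishes on
    every state of the decomposition with positive weight.\<close>
  have vanish: "p k * (cmod (s * \<phi> k u - t * \<phi> k v))\<^sup>2 = 0"
    if "k < K" "s * \<psi> u = t * \<psi> v"
      "u \<in> I \<times> J - {(i0, j0)}" "v \<in> I \<times> J - {(i0, j0)}" for k s t u v
  proof -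
    have "complex_of_real (\<Sum>k<K. p k * (cmod (s * \<phi> k u - t * \<phi> k v))\<^sup>2) =
      (\<Sum>k<K. s * cnj s * (p k * (\<phi> k u * cnj (\<phi> k u))) - s * cnj t * (p k * (\<phi> k u * cnj (\<phi> k v)))
         - t * cnj s * (p k * (\<phi> k v * cnj (\<phi> k u))) + t * cnj t * (p k * (\<phi> k v * cnj (\<phi> k v))))"
      by (simp add: complex_norm_square algebra_simps del: of_real_power)
    also have "\<dots> = s * cnj s * (\<psi> u * cnj (\<psi> u)) - s * cnj t * (\<psi> u * cnj (\<psi> v))
         - t * cnj s * (\<psi> v * cnj (\<psi> u)) + t * cnj t * (\<psi> v * cnj (\<psi> v))"
      using that(3,4) by (simp add: sum.distrib sum_subtractf eq flip: sum_distrib_left)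
    also have "\<dots> = (s * \<psi> u - t * \<psi> v) * cnj (s * \<psi> u - t * \<psi> v)"
      by (simp add: algebra_simps)
    also have "\<dots> = 0" using that(2) by simp
    finally have "(\<Sum>k<K. p k * (cmod (s * \<phi> k u - t * \<phi> k v))\<^sup>2) = 0"
      using of_real_eq_0_iff by blast
    then show ?thesis
      using sum_nonneg_eq_0_iff[of "{..<K}" "\<lambda>k. p k * (cmod (s * \<phi> k u - t * \<phi> k v))\<^sup>2"] p that(1)
      by simp
  qed
  \<comment> \<open>If \<open>\<psi>\<close> vanishes off the label \<open>(i0, j0)\<close>, the weights of the coefficients \<open>c\<close> need not
    sum to 1; the factor \<open>?r\<close> (then 0) covers this case too.\<close>
  obtain c :: "nat \<Rightarrow> complex" where
    c: "\<And>k u. k < K \<Longrightarrow> p k \<noteq> 0 \<Longrightarrow> u \<in> I \<times> J - {(i0, j0)} \<Longrightarrow> \<phi> k u = c k * \<psi> u"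
    and cr: "(\<Sum>k<K. p k * (cmod (c k))\<^sup>2) * ?r = ?r"
  proof (cases "\<exists>w\<in>I \<times> J - {(i0, j0)}. \<psi> w \<noteq> 0")
    case True
    then obtain w where w: "w \<in> I \<times> J - {(i0, j0)}" "\<psi> w \<noteq> 0" by blast
    \<comment> \<open>The label \<open>w\<close> serves as reference: \<open>c\<close> is read off
      there, and \<open>vanish\<close> with multipliers \<open>\<psi> w\<close> and
      \<open>\<psi> u\<close> gives proportionality at every other label.\<close>
    show ?thesis
    proof (rule that[of "\<lambda>k. \<phi> k w / \<psi> w"])
      fix k u assume k: "k < K" "p k \<noteq> 0" "u \<in> I \<times> J - {(i0, j0)}"
      show "\<phi> k u = \<phi> k w / \<psi> w * \<psi> u"
        using vanish[of k "\<psi> w" u "\<psi> u" w] k w by (simp add: field_simps)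
    next
      have "complex_of_real (\<Sum>k<K. p k * (cmod (\<phi> k w))\<^sup>2) = complex_of_real ((cmod (\<psi> w))\<^sup>2)"
        using eq[OF w(1) w(1)] by (simp add: complex_norm_square del: of_real_power)
      then have "(\<Sum>k<K. p k * (cmod (\<phi> k w))\<^sup>2) = (cmod (\<psi> w))\<^sup>2"
        using of_real_eq_iff by blast
      then have "(\<Sum>k<K. p k * (cmod (\<phi> k w / \<psi> w))\<^sup>2) = 1"
        using w by (simp add: norm_divide power_divide flip: sum_divide_distrib)
      then show "(\<Sum>k<K. p k * (cmod (\<phi> k w / \<psi> w))\<^sup>2) * ?r = ?r" by simp
    qed
  next
    case False
    \<comment> \<open>For \<open>x \<noteq> i0\<close> the entry of \<psi> at \<open>(x, j0)\<close>
      is \<open>\<alpha> x\<close>. One vanishing factor suffices for \<open>?r = 0\<close>.\<close>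
    have "\<alpha> x = 0" if "x \<in> I" for x
    proof (cases "x = i0")
      case False
      then have "\<psi> (x, j0) = 0" using \<open>\<not> (\<exists>w\<in>_. _)\<close> that J by auto
      then show ?thesis using False by (simp add: \<psi> ket_def)
    qed (use \<alpha> in simp)
    then have "?r = 0" by simp
    show ?thesis
    proof (rule that[of "\<lambda>_. 0"])
      fix k u assume k: "k < K" "p k \<noteq> 0" "u \<in> I \<times> J - {(i0, j0)}"
      then show "\<phi> k u = 0 * \<psi> u"
        using vanish[of k 1 u 0 u] False by simp
    qed (use \<open>?r = 0\<close> in simp)
  qed
  \<comment> \<open>The factor \<open>p k\<close> stays on both sides because a term of weight zero
    may be any normalized state.\<close>
  have "p k * pure_concurrence I J (\<phi> k) = p k * (cmod (c k))\<^sup>2 * (2 * ?r)" if k: "k < K" for k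
  proof (cases "p k = 0")
    case False
    have \<phi>: "\<phi> k (x, y) = c k * (\<alpha> x * ket j0 y + ket i0 x * \<beta> y) +
        \<phi> k (i0, j0) * ket i0 x * ket j0 y" if "x \<in> I" "y \<in> J" for x y
      using c[OF k False, of "(x, y)"] that \<alpha> \<beta>
      by (cases "(x, y) = (i0, j0)") (auto simp: \<psi> ket_def)
    show ?thesis
      using pure_concurrence_W[of I i0 J j0 \<alpha> \<beta>, OF I J \<alpha> \<beta> \<phi> nrm[OF k]] by simp
  qed simp
  then have "(\<Sum>k<K. p k * pure_concurrence I J (\<phi> k)) =
      (\<Sum>k<K. p k * (cmod (c k))\<^sup>2 * (2 * ?r))"
    by (intro sum.cong) auto
  also have "\<dots> = 2 * ((\<Sum>k<K. p k * (cmod (c k))\<^sup>2) * ?r)"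
    unfolding sum_distrib_right[symmetric] by simp
  finally show ?thesis using cr by simp
qed

section \<open>Existence of a decomposition and the two extrema\<close>

lemma ket_prod: "ket (i, j) (x, y) = ket i x * ket j y"
  by (simp add: ket_def)

lemma normalized_ket: "finite I \<Longrightarrow> i \<in> I \<Longrightarrow> normalized I (ket i)"
  by (simp add: normalized_def ket_def if_distrib if_distribR cong: if_cong)

text \<open>Ensures that there is an average to take extrema over: \<psi> is normalized and weighted
  by its squared norm, and \<xi> has weight \<open>q\<close>.\<close>

lemma pure_decomposition_two:
  fixes \<psi> \<xi> :: "'i vector"
  assumes \<xi>: "normalized I \<xi>" and q: "q \<ge> 0"
    and fin: "finite I" and one: "(\<Sum>x\<in>I. (cmod (\<psi> x))\<^sup>2) + q = 1"
    and \<sigma>: "\<And>u v. u \<in> I \<Longrightarrow> v \<in> I \<Longrightarrow>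
      \<sigma> u v = ketbra \<psi> \<psi> u v + complex_of_real q * ketbra \<xi> \<xi> u v"
  shows "\<exists>p \<phi>. pure_decomposition I \<sigma> 2 p \<phi>"
proof -
  define N where "N = (\<Sum>x\<in>I. (cmod (\<psi> x))\<^sup>2)"
  have N0: "N \<ge> 0" unfolding N_def by (intro sum_nonneg) simp
  \<comment> \<open>If \<psi> vanishes on \<open>I\<close>, its term has weight 0 but must still be
    a normalized vector; \<xi> fills the place.\<close>
  define \<phi> where "\<phi> = (\<lambda>x. if N = 0 then \<xi> x else \<psi> x / sqrt N)"
  have \<phi>: "normalized I \<phi>"
  proof (cases "N = 0")
    case False
    have "(\<Sum>x\<in>I. (cmod (\<psi> x / sqrt N))\<^sup>2) = (\<Sum>x\<in>I. (cmod (\<psi> x))\<^sup>2) / N"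
      using N0 by (simp add: norm_divide power_divide sum_divide_distrib)
    then show ?thesis using False by (simp add: \<phi>_def normalized_def flip: N_def)
  qed (use \<xi> in \<open>simp add: \<phi>_def\<close>)
  have "complex_of_real N * ketbra \<phi> \<phi> u v = ketbra \<psi> \<psi> u v" if "u \<in> I" "v \<in> I" for u v
  proof (cases "N = 0")
    case True
    then have "\<psi> u = 0"
      using sum_nonneg_eq_0_iff[OF fin, of "\<lambda>x. (cmod (\<psi> x))\<^sup>2"] that by (simp add: N_def)
    then show ?thesis using True by (simp add: ketbra_def)
  next
    case False
    have "complex_of_real (sqrt N) * complex_of_real (sqrt N) = complex_of_real N"
      using N0 by (simp flip: of_real_mult)
    then show ?thesis using False by (simp add: ketbra_def \<phi>_def field_simps)
  qed
  then have "pure_decomposition I \<sigma> 2 (\<lambda>k. if k = 0 then N else q) (\<lambda>k. if k = 0 then \<phi> else \<xi>)"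
    using \<xi> \<phi> N0 q one \<sigma> unfolding pure_decomposition_def
    by (auto simp: numeral_2_eq_2 N_def)
  then show ?thesis by blast
qed

text \<open>All decompositions share one average and at least one decomposition exists, so the set
  of averages is a singleton and its least and greatest elements coincide.\<close>

lemma concurrence_W:
  fixes \<alpha> :: "'i vector" and \<beta> :: "'j vector"
  assumes I: "finite I" "i0 \<in> I" and J: "finite J" "j0 \<in> J"
    and \<alpha>: "\<alpha> i0 = 0" and \<beta>: "\<beta> j0 = 0"
    and \<psi>: "\<And>x y. \<psi> (x, y) = \<alpha> x * ket j0 y + ket i0 x * \<beta> y"
    and \<sigma>: "\<And>u v. u \<in> I \<times> J \<Longrightarrow> v \<in> I \<times> J \<Longrightarrow>
      \<sigma> u v = ketbra \<psi> \<psi> u v + complex_of_real q * ketbra (ket (i0, j0)) (ket (i0, j0)) u v"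
    and q: "q \<ge> 0"
    and one: "(\<Sum>x\<in>I. (cmod (\<alpha> x))\<^sup>2) + (\<Sum>y\<in>J. (cmod (\<beta> y))\<^sup>2) + q = 1"
  shows "concurrence I J \<sigma> =
      2 * sqrt ((\<Sum>x\<in>I. (cmod (\<alpha> x))\<^sup>2) * (\<Sum>y\<in>J. (cmod (\<beta> y))\<^sup>2))" (is "_ = ?c")
    and "concurrence_of_assistance I J \<sigma> =
      2 * sqrt ((\<Sum>x\<in>I. (cmod (\<alpha> x))\<^sup>2) * (\<Sum>y\<in>J. (cmod (\<beta> y))\<^sup>2))"
proof -
  \<comment> \<open>The two parts of \<psi> are orthogonal, so \<open>one\<close> turns into the
    unit trace condition of the two-term decomposition.\<close>
  have "complex_of_real (\<Sum>z\<in>I \<times> J. (cmod (\<psi> z))\<^sup>2) = 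
      (\<Sum>x\<in>I. \<Sum>y\<in>J. (\<alpha> x * ket j0 y + ket i0 x * \<beta> y) * cnj (\<alpha> x * ket j0 y + ket i0 x * \<beta> y))"
    by (simp add: sum.cartesian_product complex_norm_square case_prod_unfold \<psi>[symmetric]
        del: of_real_power complex_cnj_add complex_cnj_mult)
  also have "\<dots> = complex_of_real ((\<Sum>x\<in>I. (cmod (\<alpha> x))\<^sup>2) + (\<Sum>y\<in>J. (cmod (\<beta> y))\<^sup>2))"
    unfolding sum_ket_orthogonal[of J j0 \<beta>, OF J \<beta>] using I
    by (simp add: sum.distrib complex_norm_square del: of_real_power)
  finally have "(\<Sum>z\<in>I \<times> J. (cmod (\<psi> z))\<^sup>2) + q = 1"
    using one of_real_eq_iff by metis
  then obtain p \<phi> where dec: "pure_decomposition (I \<times> J) \<sigma> 2 p \<phi>"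
    using pure_decomposition_two[of "I \<times> J" "ket (i0, j0)" q \<psi> \<sigma>] I J q \<sigma>
      normalized_ket[of "I \<times> J" "(i0, j0)"] by blast
  have avg: "(\<Sum>k<K. p k * pure_concurrence I J (\<phi> k)) = ?c"
    if "pure_decomposition (I \<times> J) \<sigma> K p \<phi>" for K p \<phi>
    using average_concurrence_W[of I i0 J j0 \<alpha> \<beta> \<psi> \<sigma> q K p \<phi>] assms that by blast
  have "average_concurrences I J \<sigma> = {?c}"
  proof (intro equalityI subsetI)
    fix r assume "r \<in> {?c}"
    then have "r = (\<Sum>k<2. p k * pure_concurrence I J (\<phi> k))"
      using avg[OF dec] by simp
    then show "r \<in> average_concurrences I J \<sigma>"
      unfolding average_concurrences_def using dec by blast
  qed (unfold average_concurrences_def, use avg in blast)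
  then show "concurrence I J \<sigma> = ?c" "concurrence_of_assistance I J \<sigma> = ?c"
    by (auto simp: concurrence_def concurrence_of_assistance_def intro: Least_equality Greatest_equality)
qed

section \<open>Basis labels and single-excitation vectors on a set of qudits\<close>

definition zero_conf :: "nat set \<Rightarrow> nat \<Rightarrow> nat" where
  "zero_conf X = (\<lambda>t\<in>X. 0)"

definition excited_conf :: "nat set \<Rightarrow> nat \<Rightarrow> nat \<Rightarrow> nat \<Rightarrow> nat" where
  "excited_conf X s i = (\<lambda>t\<in>X. if t = s then i else 0)"

text \<open>Left unnormalized, so that one notion covers the whole W state, both sides of a cut and
  the qudits traced out.\<close>

definition W_part :: "nat \<Rightarrow> (nat \<Rightarrow> nat \<Rightarrow> complex) \<Rightarrow> nat set \<Rightarrow> (nat \<Rightarrow> nat) vector" where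
  "W_part d a X = (\<lambda>x. \<Sum>i=1..d-1. \<Sum>s\<in>X. a s i * ket (excited_conf X s i) x)"

definition W_weight :: "nat \<Rightarrow> (nat \<Rightarrow> nat \<Rightarrow> complex) \<Rightarrow> nat set \<Rightarrow> real" where
  "W_weight d a X = (\<Sum>s\<in>X. \<Sum>i=1..d-1. (cmod (a s i))\<^sup>2)"

lemma finite_configs: "finite X \<Longrightarrow> finite (configs d X)"
  by (simp add: configs_def finite_PiE)

lemma zero_conf_in: "d \<ge> 2 \<Longrightarrow> zero_conf X \<in> configs d X"
  by (auto simp: zero_conf_def configs_def)

lemma excited_conf_in: "i < d \<Longrightarrow> excited_conf X s i \<in> configs d X"
  by (auto simp: excited_conf_def configs_def)

lemma merge_in_configs:
  "x \<in> configs d U \<Longrightarrow> y \<in> configs d V \<Longrightarrow> merge U V (x, y) \<in> configs d (U \<union> V)"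
  by (auto simp: configs_def PiE_iff merge_def extensional_def)

text \<open>Zero and excited labels are both restrictions of a function on all indices, so this
  splits either kind across a disjoint union.\<close>

lemma merge_eq_restrict_iff:
  assumes "x \<in> configs d U" "y \<in> configs d V" "U \<inter> V = {}"
  shows "merge U V (x, y) = restrict f (U \<union> V) \<longleftrightarrow> x = restrict f U \<and> y = restrict f V"
proof -
  have "x \<in> extensional U" "y \<in> extensional V"
    using assms by (auto simp: configs_def PiE_iff)
  then show ?thesis
    using assms(3) unfolding merge_def fun_eq_iff restrict_def extensional_def
    by simp (smt (verit) IntI empty_iff)
qed

lemma ket_merge_zero:
  assumes "x \<in> configs d U" "y \<in> configs d V" "U \<inter> V = {}"
  shows "ket (zero_conf (U \<union> V)) (merge U V (x, y)) = ket (zero_conf U) x * ket (zero_conf V) y"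
  using merge_eq_restrict_iff[OF assms] by (simp add: ket_def zero_conf_def)

lemma excited_conf_outside: "s \<notin> X \<Longrightarrow> excited_conf X s i = zero_conf X"
  by (auto simp: excited_conf_def zero_conf_def restrict_def)

lemma ket_merge_excited:
  assumes "x \<in> configs d U" "y \<in> configs d V" "U \<inter> V = {}"
  shows "ket (excited_conf (U \<union> V) s i) (merge U V (x, y)) =
    ket (excited_conf U s i) x * ket (excited_conf V s i) y"
  using merge_eq_restrict_iff[OF assms] by (simp add: ket_def excited_conf_def)

text \<open>The single excitation lies in \<open>U\<close> or in \<open>V\<close>, and the other
  side is then in its zero configuration.\<close>

lemma W_part_merge:
  assumes "x \<in> configs d U" "y \<in> configs d V" "U \<inter> V = {}" "finite U" "finite V"
  shows "W_part d a (U \<union> V) (merge U V (x, y)) =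
    W_part d a U x * ket (zero_conf V) y + ket (zero_conf U) x * W_part d a V y"
proof -
  have "s \<notin> V" if "s \<in> U" for s using assms(3) that by auto
  moreover have "s \<notin> U" if "s \<in> V" for s using assms(3) that by auto
  ultimately show ?thesis
    using assms unfolding W_part_def
    by (simp add: sum.union_disjoint ket_merge_excited excited_conf_outside sum.distrib
        sum_distrib_left sum_distrib_right mult_ac)
qed

text \<open>Levels start at 1 and sites lie in \<open>X\<close>, so no excited label is the zero
  label. This provides the orthogonality to \<open>ket (zero_conf X)\<close> used later.\<close>

lemma W_part_zero: "W_part d a X (zero_conf X) = 0"
  unfolding W_part_def
  by (intro sum.neutral ballI) (auto simp: ket_def zero_conf_def excited_conf_def fun_eq_iff)

text \<open>Pythagoras: injectivity of \<open>f\<close> makes the kets distinct, hence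
  orthonormal.\<close>

lemma norm_sum_ket:
  assumes "finite C" "finite T" "inj_on f T" "f ` T \<subseteq> C"
  shows "(\<Sum>z\<in>C. (cmod (\<Sum>t\<in>T. b t * ket (f t) z))\<^sup>2) = (\<Sum>t\<in>T. (cmod (b t))\<^sup>2)"
proof -
  have "(\<Sum>z\<in>C. (cmod (\<Sum>t\<in>T. b t * ket (f t) z))\<^sup>2) =
      (\<Sum>z\<in>f ` T. (cmod (\<Sum>t\<in>T. b t * ket (f t) z))\<^sup>2)"
    using assms by (intro sum.mono_neutral_right) (auto simp: ket_def intro!: sum.neutral)
  also have "\<dots> = (\<Sum>t'\<in>T. (cmod (\<Sum>t\<in>T. b t * ket (f t) (f t')))\<^sup>2)"
    using assms by (simp add: sum.reindex)
  also have "\<dots> = (\<Sum>t'\<in>T. (cmod (b t'))\<^sup>2)"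
  proof (intro sum.cong refl)
    fix t' assume "t' \<in> T"
    then have "(\<Sum>t\<in>T. b t * ket (f t) (f t')) = (\<Sum>t\<in>T. b t * ket t' t)"
      using assms by (intro sum.cong) (auto simp: ket_def dest: inj_onD)
    then show "(cmod (\<Sum>t\<in>T. b t * ket (f t) (f t')))\<^sup>2 = (cmod (b t'))\<^sup>2"
      using \<open>t' \<in> T\<close> assms by simp
  qed
  finally show ?thesis .
qed

lemma norm_W_part:
  assumes "finite X"
  shows "(\<Sum>x\<in>configs d X. (cmod (W_part d a X x))\<^sup>2) = W_weight d a X"
proof -
  define T where "T = X \<times> {1..d-1}"
  have "inj_on (\<lambda>(s, i). excited_conf X s i) T"
  proof (clarsimp simp: inj_on_def T_def)
    fix s i s' i'
    assume s: "s \<in> X" "s' \<in> X" and i: "Suc 0 \<le> i" "Suc 0 \<le> i'"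
      and eq: "excited_conf X s i = excited_conf X s' i'"
    \<comment> \<open>At its own site an excited label has a nonzero level, while a label excited
      elsewhere is 0 there.\<close>
    from s i show "s = s' \<and> i = i'"
      using fun_cong[OF eq, of s] fun_cong[OF eq, of s']
      by (cases "s = s'") (auto simp: excited_conf_def)
  qed
  moreover have "(\<lambda>(s, i). excited_conf X s i) ` T \<subseteq> configs d X"
    unfolding T_def using excited_conf_in by (auto simp: less_eq_Suc_le)
  moreover have "W_part d a X x = (\<Sum>t\<in>T. (case t of (s, i) \<Rightarrow> a s i) *
      ket ((\<lambda>(s, i). excited_conf X s i) t) x)" for x
    unfolding T_def W_part_def by (subst sum.swap) (simp add: sum.cartesian_product case_prod_unfold)
  moreover have "W_weight d a X = (\<Sum>t\<in>T. (cmod (case t of (s, i) \<Rightarrow> a s i))\<^sup>2)"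
    unfolding T_def W_weight_def by (simp add: sum.cartesian_product case_prod_unfold)
  ultimately show ?thesis
    using norm_sum_ket[of "configs d X" T] finite_configs[OF assms] assms by (simp add: T_def)
qed

section \<open>Reduced states of the mixture and their concurrences\<close>

text \<open>The trace removes interference between excitations inside and outside \<open>Z\<close>.
  An outside excitation leaves \<open>Z\<close> in the zero configuration, so its weight joins that
  of the ground state.\<close>

lemma reduced_state_W:
  assumes d: "d \<ge> 2" and Z: "Z \<subseteq> {1..n}"
    and x: "x \<in> configs d Z" and x': "x' \<in> configs d Z"
  shows "reduced_state d {1..n} (W_mixture n d a p) Z x x' =
    complex_of_real p * ketbra (W_part d a Z) (W_part d a Z) x x' +
    complex_of_real (p * W_weight d a ({1..n} - Z) + (1 - p)) *
      ketbra (ket (zero_conf Z)) (ket (zero_conf Z)) x x'"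
proof -
  define R where "R = {1..n} - Z"
  have fin: "finite Z" "finite R" and disj: "Z \<inter> R = {}" and un: "Z \<union> R = {1..n}"
    using Z finite_subset by (auto simp: R_def)
  have W: "W_state n d a = W_part d a (Z \<union> R)"
    unfolding W_state_def W_part_def excited_label_def excited_conf_def un ..
  have z: "zero_label n = zero_conf (Z \<union> R)"
    unfolding zero_label_def zero_conf_def un ..
  have R: "finite (configs d R)" "zero_conf R \<in> configs d R"
    using fin d by (simp_all add: finite_configs zero_conf_in)
  have "reduced_state d {1..n} (W_mixture n d a p) Z x x' =
    (\<Sum>y\<in>configs d R.
      p * ((W_part d a Z x * ket (zero_conf R) y + ket (zero_conf Z) x * W_part d a R y) *
       cnj (W_part d a Z x' * ket (zero_conf R) y + ket (zero_conf Z) x' * W_part d a R y)) +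
      (1 - p) * (ket (zero_conf Z) x * ket (zero_conf Z) x') * ket (zero_conf R) y)"
    unfolding reduced_state_def W_mixture_def ketbra_def W z R_def[symmetric]
  proof (intro sum.cong refl)
    fix y assume y: "y \<in> configs d R"
    show "complex_of_real p * (W_part d a (Z \<union> R) (merge Z R (x, y)) *
        cnj (W_part d a (Z \<union> R) (merge Z R (x', y)))) +
      complex_of_real (1 - p) * (ket (zero_conf (Z \<union> R)) (merge Z R (x, y)) *
        cnj (ket (zero_conf (Z \<union> R)) (merge Z R (x', y)))) =
      p * ((W_part d a Z x * ket (zero_conf R) y + ket (zero_conf Z) x * W_part d a R y) *
       cnj (W_part d a Z x' * ket (zero_conf R) y + ket (zero_conf Z) x' * W_part d a R y)) +
      (1 - p) * (ket (zero_conf Z) x * ket (zero_conf Z) x') * ket (zero_conf R) y"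
      unfolding W_part_merge[OF x y disj fin] W_part_merge[OF x' y disj fin]
        ket_merge_zero[OF x y disj] ket_merge_zero[OF x' y disj]
      by (simp add: mult_ac) (simp add: ket_def)
  qed
  also have "\<dots> = p * (W_part d a Z x * cnj (W_part d a Z x') +
      ket (zero_conf Z) x * cnj (ket (zero_conf Z) x') * W_weight d a R) +
      (1 - p) * (ket (zero_conf Z) x * ket (zero_conf Z) x')"
    unfolding sum.distrib sum_distrib_left[symmetric]
      sum_ket_orthogonal[of "configs d R" "zero_conf R" "W_part d a R", OF R W_part_zero] norm_W_part[OF fin(2)]
    using R sum_ket_mult(1)[OF R, of "\<lambda>_. 1"] by simp
  finally show ?thesis
    by (simp add: ketbra_def R_def algebra_simps)
qed

text \<open>Absorbing \<open>sqrt p\<close> into \<alpha> and \<beta> brings the reduced state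
  across the cut into the form treated by \<open>concurrence_W\<close>.\<close>

lemma conc_W:
  assumes d: "d \<ge> 2" and XY: "X \<subseteq> {1..n}" "Y \<subseteq> {1..n}" "X \<inter> Y = {}"
    and one: "W_weight d a {1..n} = 1" and p: "0 \<le> p" "p \<le> 1"
  shows "conc n d (W_mixture n d a p) X Y = 2 * p * sqrt (W_weight d a X * W_weight d a Y)"
    and "conc_assist n d (W_mixture n d a p) X Y = 2 * p * sqrt (W_weight d a X * W_weight d a Y)"
proof -
  define R where "R = {1..n} - (X \<union> Y)"
  define \<sigma> where "\<sigma> = bipartite_cut X Y (reduced_state d {1..n} (W_mixture n d a p) (X \<union> Y))"
  define \<alpha> where "\<alpha> = (\<lambda>x. sqrt p * W_part d a X x)"
  define \<beta> where "\<beta> = (\<lambda>x. sqrt p * W_part d a Y x)"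
  define \<psi> where "\<psi> = (\<lambda>(x, y). \<alpha> x * ket (zero_conf Y) y + ket (zero_conf X) x * \<beta> y)"
  define q where "q = p * W_weight d a R + (1 - p)"
  have fin: "finite X" "finite Y" using XY by (auto intro: finite_subset)
  have w0: "W_weight d a U \<ge> 0" for U
    unfolding W_weight_def by (intro sum_nonneg) simp
  have q: "q \<ge> 0" unfolding q_def using p w0 by simp
  have "W_weight d a {1..n} = W_weight d a (X \<union> Y) + W_weight d a R"
    unfolding W_weight_def R_def
    by (subst add.commute, rule sum.subset_diff) (use XY in auto)
  moreover have "W_weight d a (X \<union> Y) = W_weight d a X + W_weight d a Y"
    unfolding W_weight_def using fin XY by (intro sum.union_disjoint) auto
  ultimately have R: "W_weight d a R = 1 - W_weight d a X - W_weight d a Y"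
    using one by linarith
  \<comment> \<open>Unit trace: all weight missing from \<open>X\<close> and \<open>Y\<close> sits
    in \<open>q\<close>.\<close>
  have tot: "p * W_weight d a X + p * W_weight d a Y + q = 1"
    unfolding q_def R by (simp add: algebra_simps)
  have A: "(\<Sum>x\<in>configs d X. (cmod (\<alpha> x))\<^sup>2) = p * W_weight d a X"
    unfolding norm_W_part[OF fin(1), symmetric] sum_distrib_left using p
    by (intro sum.cong) (simp_all add: \<alpha>_def norm_mult power_mult_distrib)
  have B: "(\<Sum>x\<in>configs d Y. (cmod (\<beta> x))\<^sup>2) = p * W_weight d a Y"
    unfolding norm_W_part[OF fin(2), symmetric] sum_distrib_left using p
    by (intro sum.cong) (simp_all add: \<beta>_def norm_mult power_mult_distrib)
  have sp: "complex_of_real (sqrt p) * complex_of_real (sqrt p) = complex_of_real p"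
    using p by (simp flip: of_real_mult)
  have \<sigma>: "\<sigma> u v = ketbra \<psi> \<psi> u v + complex_of_real q *
      ketbra (ket (zero_conf X, zero_conf Y)) (ket (zero_conf X, zero_conf Y)) u v"
    if uv: "u \<in> configs d X \<times> configs d Y" "v \<in> configs d X \<times> configs d Y" for u v
  proof -
    have *: "W_part d a (X \<union> Y) (merge X Y w) * complex_of_real (sqrt p) = \<psi> w"
      "ket (zero_conf (X \<union> Y)) (merge X Y w) = ket (zero_conf X, zero_conf Y) w"
      "merge X Y w \<in> configs d (X \<union> Y)"
      if "w \<in> configs d X \<times> configs d Y" for w
      using that XY fin
      by (auto simp: W_part_merge \<psi>_def \<alpha>_def \<beta>_def ket_merge_zero[where d=d] ket_prod
          algebra_simps intro: merge_in_configs)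
    have "\<sigma> u v = complex_of_real p * ketbra (W_part d a (X \<union> Y)) (W_part d a (X \<union> Y))
        (merge X Y u) (merge X Y v) + complex_of_real q *
        ketbra (ket (zero_conf (X \<union> Y))) (ket (zero_conf (X \<union> Y))) (merge X Y u) (merge X Y v)"
      unfolding \<sigma>_def bipartite_cut_def q_def R_def
      by (rule reduced_state_W) (use d XY *(3) uv in auto)
    also have "\<dots> = ketbra \<psi> \<psi> u v + complex_of_real q *
      ketbra (ket (zero_conf X, zero_conf Y)) (ket (zero_conf X, zero_conf Y)) u v"
      using uv by (simp add: ketbra_def * flip: *(1) sp)
    finally show ?thesis .
  qed
  have c: "concurrence (configs d X) (configs d Y) \<sigma> =
      2 * sqrt (p * W_weight d a X * (p * W_weight d a Y))"
    "concurrence_of_assistance (configs d X) (configs d Y) \<sigma> =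
      2 * sqrt (p * W_weight d a X * (p * W_weight d a Y))"
    unfolding A[symmetric] B[symmetric]
    by (rule concurrence_W[of _ "zero_conf X" _ "zero_conf Y" \<alpha> \<beta> \<psi> \<sigma> q];
        use fin d q \<sigma> tot in \<open>simp add: finite_configs zero_conf_in \<alpha>_def \<beta>_def W_part_zero \<psi>_def
          A[unfolded \<alpha>_def] B[unfolded \<beta>_def]\<close>)+
  have "sqrt (p * W_weight d a X * (p * W_weight d a Y)) = p * sqrt (W_weight d a X * W_weight d a Y)"
    using p by (simp add: real_sqrt_mult)
  then show "conc n d (W_mixture n d a p) X Y = 2 * p * sqrt (W_weight d a X * W_weight d a Y)"
    "conc_assist n d (W_mixture n d a p) X Y = 2 * p * sqrt (W_weight d a X * W_weight d a Y)"
    using c by (simp_all add: conc_def conc_assist_def \<sigma>_def)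
qed

section \<open>The monogamy relations\<close>

theorem theorem1:
  fixes n d :: nat and a :: "nat \<Rightarrow> nat \<Rightarrow> complex" and p :: real
    and \<rho> :: "(nat \<Rightarrow> nat) operator"
  assumes "n \<ge> 1" and "d \<ge> 2"
    and "(\<Sum>s=1..n. \<Sum>i=1..d-1. (cmod (a s i))\<^sup>2) = 1"
    and "0 \<le> p" and "p \<le> 1"
    and "\<rho> = W_mixture n d a p"
  shows "(conc n d \<rho> {1} {2..n})\<^sup>2 = (\<Sum>t=2..n. (conc n d \<rho> {1} {t})\<^sup>2)
    \<and> (\<forall>t\<in>{2..n}. conc n d \<rho> {1} {t} = conc_assist n d \<rho> {1} {t})
    \<and> (\<forall>P. partition_on {1..n} P \<longrightarrow> (\<forall>Q\<in>P.
          (conc n d \<rho> Q (\<Union>(P - {Q})))\<^sup>2 = (\<Sum>R\<in>P - {Q}. (conc n d \<rho> Q R)\<^sup>2)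
        \<and> (\<Sum>R\<in>P - {Q}. (conc n d \<rho> Q R)\<^sup>2) = (\<Sum>R\<in>P - {Q}. (conc_assist n d \<rho> Q R)\<^sup>2)
        \<and> (\<forall>R\<in>P - {Q}. conc n d \<rho> Q R = conc_assist n d \<rho> Q R)))"
proof -
  let ?w = "W_weight d a"
  have w0: "?w U \<ge> 0" for U
    unfolding W_weight_def by (intro sum_nonneg) simp
  have one: "?w {1..n} = 1" using assms(3) by (simp add: W_weight_def)
  note conc_\<rho> = conc_W[OF assms(2) _ _ _ one assms(4,5), folded assms(6)]
  have eq: "conc n d \<rho> X Y = conc_assist n d \<rho> X Y"
    if "X \<subseteq> {1..n}" "Y \<subseteq> {1..n}" "X \<inter> Y = {}" for X Y
    using that by (simp add: conc_\<rho>)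
  have sq: "(conc n d \<rho> X Y)\<^sup>2 = (2 * p)\<^sup>2 * ?w X * ?w Y"
    if "X \<subseteq> {1..n}" "Y \<subseteq> {1..n}" "X \<inter> Y = {}" for X Y
    using that w0 by (simp add: conc_\<rho> power_mult_distrib)
  \<comment> \<open>For fixed \<open>X\<close>, the squared concurrence is proportional to the
    weight of the other party, which is additive over disjoint unions. An empty family gives 0 on
    both sides.\<close>
  have mono: "(conc n d \<rho> X (\<Union>\<Y>))\<^sup>2 = (\<Sum>Y\<in>\<Y>. (conc n d \<rho> X Y)\<^sup>2)"
    if X: "X \<subseteq> {1..n}" and \<Y>: "\<And>Y. Y \<in> \<Y> \<Longrightarrow> Y \<subseteq> {1..n} \<and> X \<inter> Y = {}" and "disjoint \<Y>" for X \<Y>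
  proof -
    have "?w (\<Union>\<Y>) = (\<Sum>Y\<in>\<Y>. ?w Y)"
      unfolding W_weight_def using \<Y> \<open>disjoint \<Y>\<close> finite_subset[of _ "{1..n}"]
      by (subst sum.Union_disjoint) (auto simp: disjoint_def)
    moreover have "(conc n d \<rho> X (\<Union>\<Y>))\<^sup>2 = (2 * p)\<^sup>2 * ?w X * ?w (\<Union>\<Y>)"
      by (rule sq) (use X \<Y> in auto)
    moreover have "(\<Sum>Y\<in>\<Y>. (conc n d \<rho> X Y)\<^sup>2) = (\<Sum>Y\<in>\<Y>. (2 * p)\<^sup>2 * ?w X * ?w Y)"
      by (intro sum.cong refl sq) (use X \<Y> in auto)
    ultimately show ?thesis by (simp add: sum_distrib_left)
  qed
  show ?thesis
  proof (intro conjI allI impI ballI)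
    \<comment> \<open>The first identity is the case of the family of singletons from
      \<open>{2..n}\<close>.\<close>
    have "(conc n d \<rho> {1} (\<Union>((\<lambda>t. {t}) ` {2..n})))\<^sup>2 =
        (\<Sum>Y\<in>(\<lambda>t. {t}) ` {2..n}. (conc n d \<rho> {1} Y)\<^sup>2)"
      by (rule mono) (use assms(1) in \<open>auto simp: disjoint_def\<close>)
    then show "(conc n d \<rho> {1} {2..n})\<^sup>2 = (\<Sum>t=2..n. (conc n d \<rho> {1} {t})\<^sup>2)"
      by (simp add: sum.reindex)
  next
    fix t assume "t \<in> {2..n}"
    then show "conc n d \<rho> {1} {t} = conc_assist n d \<rho> {1} {t}"
      using assms(1) by (intro eq) auto
  next
    fix P Q assume P: "partition_on {1..n} P" and Q: "Q \<in> P"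
    have sub: "R \<subseteq> {1..n}" if "R \<in> P" for R
      using P that by (auto simp: partition_on_def)
    have disj: "Q \<inter> R = {}" if "R \<in> P - {Q}" for R
      using P Q that by (auto simp: partition_on_def disjoint_def)
    show QR: "conc n d \<rho> Q R = conc_assist n d \<rho> Q R" if "R \<in> P - {Q}" for R
      using that Q by (intro eq sub disj) auto
    show "(\<Sum>R\<in>P - {Q}. (conc n d \<rho> Q R)\<^sup>2) = (\<Sum>R\<in>P - {Q}. (conc_assist n d \<rho> Q R)\<^sup>2)"
      by (intro sum.cong) (simp_all add: QR)
    show "(conc n d \<rho> Q (\<Union>(P - {Q})))\<^sup>2 = (\<Sum>R\<in>P - {Q}. (conc n d \<rho> Q R)\<^sup>2)"
      by (rule mono) (use P Q sub disj in \<open>auto simp: partition_on_def disjoint_def\<close>)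
  qed
qed

end
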